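(* The group $E_{6(6),\mathbb C'}=\{\alpha\in \mathrm{Iso}_{\mathbb R}(\mathfrak J(3,\mathbb C')) \mid \det(\alpha X)=\det X \text{ for all } X\}$ is isomorphic to the semi-direct product of the groups $SU(3,\mathbb C')\times SU(3,\mathbb C')$ and $\mathbb Z_2=\{1,\varepsilon\}$: $$E_{6(6),\mathbb C'}\cong (SU(3,\mathbb C')\times SU(3,\mathbb C'))\rtimes\mathbb Z_2,$$ where $\varepsilon$ acts by $\varepsilon(A,B)=(\overline B,\overline A)$.
   Context: $\mathbb C'=\mathbb R\oplus\mathbb R\mathbf i'$, $\mathbf i'^2=1$, is the algebra of split complex numbers with conjugation $\overline{x+y\mathbf i'}=x-y\mathbf i'$. For a matrix $A$ over $\mathbb C'$, $\overline A$ is entrywise conjugation and $A^*={}^t\overline A$. $\mathfrak J(3,\mathbb C')=\{X\in M(3,\mathbb C')\mid X^*=X\}$, whose elements are $X=\begin{pmatrix}\xi_1&x_3&\overline x_2\\ \overline x_3&\xi_2&x_1\\ x_2&\overline x_1&\xi_3\end{pmatrix}$, $\xi_i\in\mathbb R$, $x_i\in\mathbb C'$, and $\det X=\xi_1\xi_2\xi_3+x_1x_2x_3+\overline{x_1x_2x_3}-\sum_i\xi_ix_i\overline x_i\in\mathbb R$. $SU(3,\mathbb C')=\{A\in M(3,\mathbb C')\mid AA^*=E,\ \det A=1\}$. $\mathrm{Iso}_{\mathbb R}(V)$ is the group of $\mathbb R$-linear automorphisms of $V$. *)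

theory Defs
  imports
    "HOL-Analysis.Analysis"
    "HOL-Algebra.Bij"
    "HOL-Algebra.Elementary_Groups"
begin

section \<open>Split complex numbers\<close>

text \<open>\<open>SC x y\<close> stands for \<open>x + y i'\<close> with \<open>i' * i' = 1\<close>.\<close>

datatype split_complex = SC (sRe: real) (sIm: real)

lemma split_complex_eq_iff: "z = w \<longleftrightarrow> sRe z = sRe w \<and> sIm z = sIm w"
  by (cases z; cases w) auto

instantiation split_complex :: comm_ring_1
begin

definition "0 = SC 0 0"
definition "1 = SC 1 0"
definition "z + w = SC (sRe z + sRe w) (sIm z + sIm w)"
definition "z - w = SC (sRe z - sRe w) (sIm z - sIm w)"
definition "- z = SC (- sRe z) (- sIm z)"
definition "z * w = SC (sRe z * sRe w + sIm z * sIm w) (sRe z * sIm w + sIm z * sRe w)"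

instance
  by standard
    (auto simp: split_complex_eq_iff zero_split_complex_def one_split_complex_def
      plus_split_complex_def minus_split_complex_def uminus_split_complex_def
      times_split_complex_def algebra_simps)

end

instantiation split_complex :: real_algebra_1
begin

definition "scaleR r z = SC (r * sRe z) (r * sIm z)"

instance
  by standard
    (auto simp: split_complex_eq_iff scaleR_split_complex_def
      plus_split_complex_def times_split_complex_def algebra_simps)

end

lemma split_complex_sel [simp]:
  "sRe 0 = 0" "sIm 0 = 0" "sRe 1 = 1" "sIm 1 = 0"
  "sRe (z + w) = sRe z + sRe w" "sIm (z + w) = sIm z + sIm w"
  "sRe (z - w) = sRe z - sRe w" "sIm (z - w) = sIm z - sIm w"
  "sRe (- z) = - sRe z" "sIm (- z) = - sIm z"
  "sRe (z * w) = sRe z * sRe w + sIm z * sIm w"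
  "sIm (z * w) = sRe z * sIm w + sIm z * sRe w"
  "sRe (r *\<^sub>R z) = r * sRe z" "sIm (r *\<^sub>R z) = r * sIm z"
  by (simp_all add: zero_split_complex_def one_split_complex_def
      plus_split_complex_def minus_split_complex_def uminus_split_complex_def
      times_split_complex_def scaleR_split_complex_def)

lemma sRe_of_real [simp]: "sRe (of_real r) = r"
  and sIm_of_real [simp]: "sIm (of_real r) = 0"
  by (simp_all add: of_real_def)

lemma sRe_numeral [simp]: "sRe (numeral n) = numeral n"
  and sIm_numeral [simp]: "sIm (numeral n) = 0"
  using sRe_of_real[of "numeral n"] sIm_of_real[of "numeral n"] by simp_all

lemma sRe_sum [simp]: "sRe (sum f S) = (\<Sum>x\<in>S. sRe (f x))"
  and sIm_sum [simp]: "sIm (sum f S) = (\<Sum>x\<in>S. sIm (f x))"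
  by (induction S rule: infinite_finite_induct; simp)+

lemma split_unit_square: "SC 0 1 * SC 0 1 = 1"
  by (simp add: split_complex_eq_iff)

definition scnj :: "split_complex \<Rightarrow> split_complex"
  where "scnj z = SC (sRe z) (- sIm z)"

lemma sRe_scnj [simp]: "sRe (scnj z) = sRe z"
  and sIm_scnj [simp]: "sIm (scnj z) = - sIm z"
  by (simp_all add: scnj_def)

lemma scnj_simps [simp]:
  "scnj (scnj z) = z" "scnj 0 = 0" "scnj 1 = 1" "scnj (z + w) = scnj z + scnj w"
  "scnj (z - w) = scnj z - scnj w"
  "scnj (- z) = - scnj z" "scnj (z * w) = scnj z * scnj w" "scnj (r *\<^sub>R z) = r *\<^sub>R scnj z"
  by (simp_all add: split_complex_eq_iff algebra_simps)

lemma scnj_sum: "scnj (sum f S) = (\<Sum>x\<in>S. scnj (f x))"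
  by (induction S rule: infinite_finite_induct) auto


section \<open>Matrices and the group \<open>SU(3, C')\<close>\<close>

definition mcnj :: "split_complex^'n^'m \<Rightarrow> split_complex^'n^'m"
  where "mcnj A = (\<chi> i j. scnj (A $ i $ j))"

definition adjoint_mat :: "split_complex^'n^'m \<Rightarrow> split_complex^'m^'n"
  where "adjoint_mat A = transpose (mcnj A)"

definition SU3 :: "(split_complex^3^3) monoid"
  where "SU3 = \<lparr>carrier = {A. A ** adjoint_mat A = mat 1 \<and> det A = 1},
                monoid.mult = (**), one = mat 1\<rparr>"

lemma mcnj_mcnj [simp]: "mcnj (mcnj A) = A"
  by (simp add: mcnj_def vec_eq_iff)

lemma mcnj_mult: "mcnj (A ** B) = mcnj A ** mcnj B"
  by (simp add: mcnj_def matrix_matrix_mult_def vec_eq_iff scnj_sum)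

lemma mcnj_one [simp]: "mcnj (mat 1) = mat 1"
  by (auto simp: mcnj_def mat_def vec_eq_iff)

lemma det_mcnj: "det (mcnj A) = scnj (det A)" for A :: "split_complex^3^3"
  by (simp add: det_3 mcnj_def)

lemma adjoint_mcnj: "adjoint_mat (mcnj A) = mcnj (adjoint_mat A)"
  by (simp add: adjoint_mat_def mcnj_def transpose_def)

lemma adjoint_adjoint [simp]: "adjoint_mat (adjoint_mat A) = A"
  by (simp add: adjoint_mat_def mcnj_def transpose_def vec_eq_iff)

lemma adjoint_mult: "adjoint_mat (A ** B) = adjoint_mat B ** adjoint_mat A"
  by (simp add: adjoint_mat_def mcnj_mult matrix_transpose_mul)

lemma adjoint_one [simp]: "adjoint_mat (mat 1) = mat 1"
  by (simp add: adjoint_mat_def)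

lemma det_adjoint: "det (adjoint_mat A) = scnj (det A)" for A :: "split_complex^3^3"
  by (simp add: adjoint_mat_def det_mcnj)

text \<open>The two ring homomorphisms \<open>x + y i' \<mapsto> x + y\<close> and \<open>x + y i' \<mapsto> x - y\<close> to the reals,
  applied entrywise, reduce one-sided inverses over the split complex numbers to the real case.\<close>

definition mplus :: "split_complex^'n^'m \<Rightarrow> real^'n^'m"
  where "mplus A = (\<chi> i j. sRe (A $ i $ j) + sIm (A $ i $ j))"

definition mminus :: "split_complex^'n^'m \<Rightarrow> real^'n^'m"
  where "mminus A = (\<chi> i j. sRe (A $ i $ j) - sIm (A $ i $ j))"

lemma mplus_mult: "mplus (A ** B) = mplus A ** mplus B"
  by (simp add: mplus_def matrix_matrix_mult_def vec_eq_iff algebra_simps flip: sum.distrib)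

lemma mminus_mult: "mminus (A ** B) = mminus A ** mminus B"
  by (simp add: mminus_def matrix_matrix_mult_def vec_eq_iff algebra_simps
      flip: sum.distrib sum_subtractf)

lemma mplus_one: "mplus (mat 1) = mat 1" and mminus_one: "mminus (mat 1) = mat 1"
  by (auto simp: mplus_def mminus_def mat_def vec_eq_iff)

lemma mplus_mminus_eqI:
  assumes "mplus A = mplus B" "mminus A = mminus B"
  shows "A = B"
proof -
  have "A $ i $ j = B $ i $ j" for i j
  proof -
    have "sRe (A $ i $ j) + sIm (A $ i $ j) = sRe (B $ i $ j) + sIm (B $ i $ j)"
      using arg_cong[OF assms(1), of "\<lambda>M. M $ i $ j"] by (simp add: mplus_def)
    moreover have "sRe (A $ i $ j) - sIm (A $ i $ j) = sRe (B $ i $ j) - sIm (B $ i $ j)"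
      using arg_cong[OF assms(2), of "\<lambda>M. M $ i $ j"] by (simp add: mminus_def)
    ultimately show ?thesis by (simp add: split_complex_eq_iff)
  qed
  then show ?thesis by (simp add: vec_eq_iff)
qed

lemma split_matrix_left_right_inverse:
  fixes A B :: "split_complex^'n^'n"
  assumes "A ** B = mat 1"
  shows "B ** A = mat 1"
proof (rule mplus_mminus_eqI)
  have "mplus A ** mplus B = mat 1" "mminus A ** mminus B = mat 1"
    using assms by (metis mplus_mult mplus_one, metis mminus_mult mminus_one)
  then have "mplus B ** mplus A = mat 1" "mminus B ** mminus A = mat 1"
    using matrix_left_right_inverse by blast+
  then show "mplus (B ** A) = mplus (mat 1)" "mminus (B ** A) = mminus (mat 1)"
    by (simp_all add: mplus_mult mminus_mult mplus_one mminus_one)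
qed

lemma group_SU3: "group SU3"
proof (rule groupI)
  fix A B assume "A \<in> carrier SU3" "B \<in> carrier SU3"
  then have A: "A ** adjoint_mat A = mat 1" "det A = 1"
    and B: "B ** adjoint_mat B = mat 1" "det B = 1"
    by (auto simp: SU3_def)
  have "(A ** B) ** adjoint_mat (A ** B) = A ** (B ** adjoint_mat B) ** adjoint_mat A"
    by (simp add: adjoint_mult matrix_mul_assoc)
  with A B show "A \<otimes>\<^bsub>SU3\<^esub> B \<in> carrier SU3"
    by (simp add: SU3_def det_mul)
next
  fix A assume "A \<in> carrier SU3"
  then have A: "A ** adjoint_mat A = mat 1" "det A = 1"
    by (auto simp: SU3_def)
  then have "adjoint_mat A ** A = mat 1"
    using split_matrix_left_right_inverse by blast
  with A show "\<exists>B\<in>carrier SU3. B \<otimes>\<^bsub>SU3\<^esub> A = \<one>\<^bsub>SU3\<^esub>"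
    by (intro bexI[of _ "adjoint_mat A"]) (auto simp: SU3_def det_adjoint)
qed (auto simp: SU3_def matrix_mul_assoc)


section \<open>The space \<open>J(3, C')\<close> and its determinant-preserving automorphisms\<close>

definition J3 :: "(split_complex^3^3) set"
  where "J3 = {X. adjoint_mat X = X}"

definition jmat :: "real \<Rightarrow> real \<Rightarrow> real \<Rightarrow> split_complex \<Rightarrow> split_complex \<Rightarrow> split_complex
    \<Rightarrow> split_complex^3^3"
  where "jmat \<xi>1 \<xi>2 \<xi>3 x1 x2 x3 =
    vector [vector [of_real \<xi>1, x3, scnj x2],
            vector [scnj x3, of_real \<xi>2, x1],
            vector [x2, scnj x1, of_real \<xi>3]]"

text \<open>On \<open>J3\<close> the formula below has a real value, so taking \<open>sRe\<close> only changes the type;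
  see \<open>of_real_jdet_jmat\<close>.\<close>

definition jdet :: "split_complex^3^3 \<Rightarrow> real"
  where "jdet X =
    (let \<xi>1 = X $ 1 $ 1; \<xi>2 = X $ 2 $ 2; \<xi>3 = X $ 3 $ 3;
         x1 = X $ 2 $ 3; x2 = X $ 3 $ 1; x3 = X $ 1 $ 2
     in sRe (\<xi>1 * \<xi>2 * \<xi>3 + x1 * x2 * x3 + scnj (x1 * x2 * x3)
             - (\<xi>1 * (x1 * scnj x1) + \<xi>2 * (x2 * scnj x2) + \<xi>3 * (x3 * scnj x3))))"

definition real_linear_on :: "'a::real_vector set \<Rightarrow> ('a \<Rightarrow> 'a) \<Rightarrow> bool"
  where "real_linear_on V f \<longleftrightarrow>
    (\<forall>x\<in>V. \<forall>y\<in>V. f (x + y) = f x + f y) \<and> (\<forall>r. \<forall>x\<in>V. f (r *\<^sub>R x) = r *\<^sub>R f x)"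

text \<open>Automorphisms of a subspace \<open>V\<close> are elements of \<open>Bij V\<close>, i.e. they are extensional, so that
  functions agreeing on \<open>V\<close> are identified.\<close>

definition IsoR :: "'a::real_vector set \<Rightarrow> ('a \<Rightarrow> 'a) monoid"
  where "IsoR V = (BijGroup V)\<lparr>carrier := {f \<in> Bij V. real_linear_on V f}\<rparr>"

definition E6_6_C :: "(split_complex^3^3 \<Rightarrow> split_complex^3^3) monoid"
  where "E6_6_C =
    (IsoR J3)\<lparr>carrier := {\<alpha> \<in> carrier (IsoR J3). \<forall>X\<in>J3. jdet (\<alpha> X) = jdet X}\<rparr>"

lemma J3_iff_jmat: "X \<in> J3 \<longleftrightarrow> (\<exists>\<xi>1 \<xi>2 \<xi>3 x1 x2 x3. X = jmat \<xi>1 \<xi>2 \<xi>3 x1 x2 x3)"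
proof
  assume "X \<in> J3"
  then have e: "scnj (X $ j $ i) = X $ i $ j" for i j
    by (metis (mono_tags, lifting) J3_def adjoint_mat_def mcnj_def mem_Collect_eq
        transpose_def vec_lambda_beta)
  have d: "of_real (sRe (X $ i $ i)) = X $ i $ i" for i
    using arg_cong[OF e[of i i], of sIm] by (simp add: split_complex_eq_iff)
  have "X = jmat (sRe (X $ 1 $ 1)) (sRe (X $ 2 $ 2)) (sRe (X $ 3 $ 3))
              (X $ 2 $ 3) (X $ 3 $ 1) (X $ 1 $ 2)"
    by (simp add: jmat_def vec_eq_iff forall_3 d e)
  then show "\<exists>\<xi>1 \<xi>2 \<xi>3 x1 x2 x3. X = jmat \<xi>1 \<xi>2 \<xi>3 x1 x2 x3" by blast
next
  assume "\<exists>\<xi>1 \<xi>2 \<xi>3 x1 x2 x3. X = jmat \<xi>1 \<xi>2 \<xi>3 x1 x2 x3"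
  then show "X \<in> J3"
    by (auto simp: J3_def jmat_def adjoint_mat_def mcnj_def transpose_def vec_eq_iff forall_3
        split_complex_eq_iff)
qed

lemma of_real_jdet_jmat:
  "of_real (jdet (jmat \<xi>1 \<xi>2 \<xi>3 x1 x2 x3)) =
     of_real (\<xi>1 * \<xi>2 * \<xi>3) + x1 * x2 * x3 + scnj (x1 * x2 * x3)
     - (of_real \<xi>1 * (x1 * scnj x1) + of_real \<xi>2 * (x2 * scnj x2) + of_real \<xi>3 * (x3 * scnj x3))"
  by (simp add: jdet_def jmat_def split_complex_eq_iff algebra_simps)

lemma of_real_jdet: "X \<in> J3 \<Longrightarrow> of_real (jdet X) = det X"
  by (auto simp: J3_iff_jmat of_real_jdet_jmat)
    (simp add: jmat_def det_3 split_complex_eq_iff algebra_simps)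

lemma J3_add: "X \<in> J3 \<Longrightarrow> Y \<in> J3 \<Longrightarrow> X + Y \<in> J3"
  by (simp add: J3_def adjoint_mat_def mcnj_def transpose_def vec_eq_iff)

lemma J3_scaleR: "X \<in> J3 \<Longrightarrow> r *\<^sub>R X \<in> J3"
  by (simp add: J3_def adjoint_mat_def mcnj_def transpose_def vec_eq_iff)

lemma subspace_J3: "subspace J3"
  by (auto simp: subspace_def J3_add J3_scaleR)
    (simp add: J3_def adjoint_mat_def mcnj_def transpose_def vec_eq_iff)

lemma Bij_in: "f \<in> Bij V \<Longrightarrow> x \<in> V \<Longrightarrow> f x \<in> V"
  using Bij_imp_funcset by blast

lemma subgroup_IsoR:
  assumes "subspace V"
  shows "subgroup (carrier (IsoR V)) (BijGroup V)"
proof (rule group.subgroupI[OF group_BijGroup])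
  show "carrier (IsoR V) \<subseteq> carrier (BijGroup V)"
    by (auto simp: IsoR_def BijGroup_def)
  have "(\<lambda>x\<in>V. x) \<in> carrier (IsoR V)"
    using assms by (auto simp: IsoR_def id_Bij real_linear_on_def subspace_add subspace_scale)
  then show "carrier (IsoR V) \<noteq> {}" by blast
next
  fix f assume "f \<in> carrier (IsoR V)"
  then have f: "f \<in> Bij V" "real_linear_on V f" by (auto simp: IsoR_def)
  let ?g = "\<lambda>x\<in>V. inv_into V f x"
  have gB: "?g \<in> Bij V" using f by (simp add: restrict_inv_into_Bij)
  have b: "bij_betw f V V" using f by (simp add: Bij_def)
  have fg: "f (?g x) = x" if "x \<in> V" for x
    using b that by (simp add: bij_betw_inv_into_right)
  have eqI: "x = y" if "x \<in> V" "y \<in> V" "f x = f y" for x y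
    using b that by (meson bij_betw_imp_inj_on inj_onD)
  have gV: "?g x \<in> V" if "x \<in> V" for x
    using Bij_in[OF gB that] .
  have "real_linear_on V ?g"
    unfolding real_linear_on_def
  proof (intro conjI ballI allI)
    fix x y assume xy: "x \<in> V" "y \<in> V"
    have "f (?g x + ?g y) = f (?g x) + f (?g y)"
      using f(2) gV[OF xy(1)] gV[OF xy(2)] unfolding real_linear_on_def by blast
    also have "\<dots> = f (?g (x + y))"
      unfolding fg[OF xy(1)] fg[OF xy(2)] fg[OF subspace_add[OF assms xy]] ..
    finally show "?g (x + y) = ?g x + ?g y"
      using eqI[OF gV[OF subspace_add[OF assms xy]]
          subspace_add[OF assms gV[OF xy(1)] gV[OF xy(2)]]] by metis
  next
    fix r x assume x: "x \<in> V"
    have "f (r *\<^sub>R ?g x) = r *\<^sub>R f (?g x)"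
      using f(2) gV[OF x] unfolding real_linear_on_def by blast
    also have "\<dots> = f (?g (r *\<^sub>R x))"
      unfolding fg[OF x] fg[OF subspace_scale[OF assms x]] ..
    finally show "?g (r *\<^sub>R x) = r *\<^sub>R ?g x"
      using eqI[OF gV[OF subspace_scale[OF assms x]] subspace_scale[OF assms gV[OF x]]] by metis
  qed
  with gB f show "inv\<^bsub>BijGroup V\<^esub> f \<in> carrier (IsoR V)"
    by (simp add: inv_BijGroup IsoR_def)
next
  fix f g assume "f \<in> carrier (IsoR V)" "g \<in> carrier (IsoR V)"
  then show "f \<otimes>\<^bsub>BijGroup V\<^esub> g \<in> carrier (IsoR V)"
    using assms
    by (auto simp: IsoR_def BijGroup_def compose_Bij[unfolded compose_def] real_linear_on_def
        compose_def Bij_in subspace_add subspace_scale)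
qed

lemma group_IsoR: "subspace V \<Longrightarrow> group (IsoR V)"
  using subgroup.subgroup_is_group[OF subgroup_IsoR group_BijGroup, of V]
  by (simp add: IsoR_def)

lemma group_E6_6_C: "group E6_6_C"
proof -
  have "subgroup (carrier E6_6_C) (BijGroup J3)"
  proof (rule group.subgroupI[OF group_BijGroup])
    show "carrier E6_6_C \<subseteq> carrier (BijGroup J3)"
      by (auto simp: E6_6_C_def IsoR_def BijGroup_def)
    have "(\<lambda>x\<in>J3. x) \<in> carrier (IsoR J3)"
      using subgroup.one_closed[OF subgroup_IsoR[OF subspace_J3]] by (simp add: BijGroup_def)
    then have "(\<lambda>x\<in>J3. x) \<in> carrier E6_6_C"
      by (simp add: E6_6_C_def)
    then show "carrier E6_6_C \<noteq> {}" by blast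
  next
    fix f assume f: "f \<in> carrier E6_6_C"
    then have i: "f \<in> carrier (IsoR J3)" and B: "f \<in> Bij J3"
      and p: "\<And>X. X \<in> J3 \<Longrightarrow> jdet (f X) = jdet X"
      by (auto simp: E6_6_C_def IsoR_def)
    have "jdet (inv_into J3 f X) = jdet X" if "X \<in> J3" for X
      using p[of "inv_into J3 f X"] B that
      by (simp add: Bij_inv_into_mem) (metis Bij_def Int_iff bij_betw_inv_into_right mem_Collect_eq)
    then show "inv\<^bsub>BijGroup J3\<^esub> f \<in> carrier E6_6_C"
      using subgroup.m_inv_closed[OF subgroup_IsoR[OF subspace_J3] i] B
      by (simp add: E6_6_C_def inv_BijGroup)
  next
    fix f g assume "f \<in> carrier E6_6_C" "g \<in> carrier E6_6_C"
    then show "f \<otimes>\<^bsub>BijGroup J3\<^esub> g \<in> carrier E6_6_C"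
      using subgroup.m_closed[OF subgroup_IsoR[OF subspace_J3], of f g]
      by (auto simp: E6_6_C_def) (auto simp: IsoR_def BijGroup_def compose_def Bij_in)
  qed
  from subgroup.subgroup_is_group[OF this group_BijGroup] show ?thesis
    by (simp add: E6_6_C_def IsoR_def)
qed


section \<open>Semi-direct products\<close>

text \<open>\<open>\<phi>\<close> is meant to be an action of \<open>H\<close> on \<open>N\<close> by group automorphisms.\<close>

definition semidirect_product ::
  "('a, 'c) monoid_scheme \<Rightarrow> ('b, 'd) monoid_scheme \<Rightarrow> ('b \<Rightarrow> 'a \<Rightarrow> 'a) \<Rightarrow> ('a \<times> 'b) monoid"
  where "semidirect_product N H \<phi> =
    \<lparr>carrier = carrier N \<times> carrier H,
     monoid.mult = (\<lambda>(n, h) (n', h'). (n \<otimes>\<^bsub>N\<^esub> \<phi> h n', h \<otimes>\<^bsub>H\<^esub> h')),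
     one = (\<one>\<^bsub>N\<^esub>, \<one>\<^bsub>H\<^esub>)\<rparr>"

lemma group_semidirect_product:
  assumes N: "group N" and H: "group H"
    and aut: "\<And>h. h \<in> carrier H \<Longrightarrow> \<phi> h \<in> iso N N"
    and one: "\<And>n. n \<in> carrier N \<Longrightarrow> \<phi> \<one>\<^bsub>H\<^esub> n = n"
    and mult: "\<And>h k n. h \<in> carrier H \<Longrightarrow> k \<in> carrier H \<Longrightarrow> n \<in> carrier N
      \<Longrightarrow> \<phi> (h \<otimes>\<^bsub>H\<^esub> k) n = \<phi> h (\<phi> k n)"
  shows "group (semidirect_product N H \<phi>)"
proof -
  interpret N: group N by fact
  interpret H: group H by fact
  have hom: "\<phi> h \<in> hom N N" if "h \<in> carrier H" for h
    using aut[OF that] by (simp add: iso_def)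
  have cl: "\<phi> h n \<in> carrier N" if "h \<in> carrier H" "n \<in> carrier N" for h n
    using hom_in_carrier[OF hom] that by blast
  have mu: "\<phi> h (n \<otimes>\<^bsub>N\<^esub> m) = \<phi> h n \<otimes>\<^bsub>N\<^esub> \<phi> h m"
    if "h \<in> carrier H" "n \<in> carrier N" "m \<in> carrier N" for h n m
    using hom_mult[OF hom] that by blast
  have inv: "\<exists>n'\<in>carrier N. \<exists>h'\<in>carrier H. n' \<otimes>\<^bsub>N\<^esub> \<phi> h' n = \<one>\<^bsub>N\<^esub> \<and> h' \<otimes>\<^bsub>H\<^esub> h = \<one>\<^bsub>H\<^esub>"
    if "n \<in> carrier N" "h \<in> carrier H" for n h
    using that cl
    by (intro bexI[of _ "inv\<^bsub>N\<^esub> (\<phi> (inv\<^bsub>H\<^esub> h) n)"] bexI[of _ "inv\<^bsub>H\<^esub> h"]) auto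
  show ?thesis
    by (rule groupI)
      (auto simp: semidirect_product_def cl mu one mult N.m_assoc H.m_assoc inv)
qed


section \<open>The action of \<open>Z\<^sub>2\<close> on \<open>SU(3, C') \<times> SU(3, C')\<close>\<close>

definition eps_map :: "(split_complex^3^3) \<times> (split_complex^3^3) \<Rightarrow> (split_complex^3^3) \<times> (split_complex^3^3)"
  where "eps_map = (\<lambda>(A, B). (mcnj B, mcnj A))"

text \<open>\<open>Z\<^sub>2 = {1, \<epsilon>}\<close> is \<open>integer_mod_group 2\<close>, written additively: \<open>0\<close> is the identity
  and \<open>1\<close> is \<open>\<epsilon>\<close>.\<close>

definition eps_action :: "int \<Rightarrow> (split_complex^3^3) \<times> (split_complex^3^3) \<Rightarrow> (split_complex^3^3) \<times> (split_complex^3^3)"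
  where "eps_action k = (if k = 0 then id else eps_map)"

lemma mcnj_SU3: "A \<in> carrier SU3 \<Longrightarrow> mcnj A \<in> carrier SU3"
  by (simp add: SU3_def adjoint_mcnj det_mcnj flip: mcnj_mult)

lemma eps_map_iso: "eps_map \<in> iso (SU3 \<times>\<times> SU3) (SU3 \<times>\<times> SU3)"
proof -
  have "eps_map \<in> hom (SU3 \<times>\<times> SU3) (SU3 \<times>\<times> SU3)"
    by (auto simp: hom_def eps_map_def DirProd_def mcnj_SU3) (auto simp: SU3_def mcnj_mult)
  moreover have "bij_betw eps_map (carrier (SU3 \<times>\<times> SU3)) (carrier (SU3 \<times>\<times> SU3))"
    by (rule bij_betw_byWitness[where f' = eps_map]) (auto simp: eps_map_def mcnj_SU3)
  ultimately show ?thesis by (simp add: iso_def)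
qed

lemma group_SU3_semidirect:
  "group (semidirect_product (SU3 \<times>\<times> SU3) (integer_mod_group 2) eps_action)"
proof (rule group_semidirect_product)
  show "eps_action h \<in> iso (SU3 \<times>\<times> SU3) (SU3 \<times>\<times> SU3)" for h
    using eps_map_iso by (auto simp: eps_action_def iso_def hom_def)
  show "eps_action (h \<otimes>\<^bsub>integer_mod_group 2\<^esub> k) n = eps_action h (eps_action k n)"
    if "h \<in> carrier (integer_mod_group 2)" "k \<in> carrier (integer_mod_group 2)" for h k n
  proof -
    have "h = 0 \<or> h = 1" "k = 0 \<or> k = 1"
      using that by (auto simp: carrier_integer_mod_group)
    then show ?thesis
      by (auto simp: eps_action_def eps_map_def split: prod.split)
  qed
qed (simp_all add: DirProd_group group_SU3 eps_action_def)

end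

theory Submission
  imports Defs
begin

text \<open>The homomorphism \<open>x + y i' \<mapsto> x + y\<close> identifies \<open>J(3, C')\<close> with the real matrices
  \<open>M(3, R)\<close>, where the determinant becomes the usual one, and \<open>SU(3, C')\<close> with \<open>SL(3, R)\<close>. The
  statement thus reduces to the theorem of Frobenius that a determinant preserving linear
  automorphism of \<open>M(3, R)\<close> has the form \<open>X \<mapsto> P X Q\<close> or \<open>X \<mapsto> P X\<^sup>T Q\<close>; over the reals, cube roots
  allow to normalise \<open>det P = det Q = 1\<close>, and this makes \<open>P\<close> and \<open>Q\<close> unique.

  Frobenius' theorem holds because such a map preserves rank one: a matrix has rank at most one iff
  the linear term of \<open>det (X + t Y)\<close> in \<open>t\<close> vanishes for all \<open>Y\<close>.\<close>

section \<open>Determinant preservers of real 3 by 3 matrices\<close>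

definition munit :: "'n \<Rightarrow> 'n \<Rightarrow> real^'n^'n"
  where "munit i j = (\<chi> a b. if a = i \<and> b = j then 1 else 0)"

lemma munit_nth [simp]: "munit i j $ a $ b = (if a = i \<and> b = j then 1 else 0)"
  by (simp add: munit_def)

lemma matrix_mult_munit_nth: "(A ** munit i j) $ a $ b = (if b = j then A $ a $ i else 0)"
  and munit_mult_matrix_nth: "(munit i j ** A) $ a $ b = (if a = i then A $ j $ b else 0)"
proof -
  have "(\<Sum>k\<in>UNIV. A $ a $ k * munit i j $ k $ b)
      = (\<Sum>k\<in>UNIV. if k = i then (if b = j then A $ a $ i else 0) else 0)"
    by (rule sum.cong) auto
  then show "(A ** munit i j) $ a $ b = (if b = j then A $ a $ i else 0)"
    by (simp add: matrix_matrix_mult_def)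
  have "(\<Sum>k\<in>UNIV. munit i j $ a $ k * A $ k $ b)
      = (\<Sum>k\<in>UNIV. if k = j then (if a = i then A $ j $ b else 0) else 0)"
    by (rule sum.cong) auto
  then show "(munit i j ** A) $ a $ b = (if a = i then A $ j $ b else 0)"
    by (simp add: matrix_matrix_mult_def)
qed

lemma transpose_munit: "transpose (munit i j) = munit j i"
  by (auto simp: transpose_def vec_eq_iff)

lemma matrix_eq_sum_munit:
  fixes X :: "real^'n::finite^'n"
  shows "X = (\<Sum>i\<in>UNIV. \<Sum>j\<in>UNIV. X $ i $ j *\<^sub>R munit i j)"
proof -
  have "(\<Sum>i\<in>UNIV. \<Sum>j\<in>UNIV. X $ i $ j *\<^sub>R munit i j) $ a $ b = X $ a $ b" for a b
  proof -
    have "(\<Sum>j\<in>UNIV. (X $ i $ j *\<^sub>R munit i j) $ a $ b) = (if i = a then X $ a $ b else 0)" for i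
      by (auto simp: if_distrib cong: if_cong)
    then show ?thesis by simp
  qed
  then show ?thesis by (simp add: vec_eq_iff)
qed

lemma linear_matrix_mult_both:
  fixes A :: "real^'n^'m" and B :: "real^'q^'p"
  shows "linear (\<lambda>X. A ** X ** B)"
  by (rule linearI)
    (simp_all add: vec_eq_iff matrix_matrix_mult_def sum.distrib sum_distrib_left algebra_simps)

section \<open>Matrices of rank at most one, described by the vanishing of all 2 by 2 minors\<close>

definition rank_le_one :: "real^'n^'n \<Rightarrow> bool"
  where "rank_le_one X \<longleftrightarrow> (\<forall>i j k l. X $ i $ j * X $ k $ l = X $ i $ l * X $ k $ j)"

text \<open>Through a nonzero entry pass a column and a row; after division of the row by that
  entry, their product is the matrix.\<close>

lemma rank_le_oneE:
  assumes "rank_le_one X"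
  obtains u v where "\<forall>i j. X $ i $ j = u i * v j"
proof (cases "\<forall>i j. X $ i $ j = 0")
  case True
  then show ?thesis using that[of "\<lambda>_. 0" "\<lambda>_. 0"] by simp
next
  case False
  then obtain a b where "X $ a $ b \<noteq> 0" by blast
  moreover have "X $ i $ j * X $ a $ b = X $ i $ b * X $ a $ j" for i j
    using assms by (simp add: rank_le_one_def)
  ultimately show ?thesis
    using that[of "\<lambda>i. X $ i $ b" "\<lambda>j. X $ a $ j / X $ a $ b"] by (simp add: field_simps)
qed

text \<open>The expression below is the coefficient of \<open>t\<close> in \<open>det (X + t Y)\<close>, i.e. the trace of
  \<open>Y\<close> times the adjugate of \<open>X\<close>.\<close>

lemma rank_le_one_iff_det:
  fixes X :: "real^3^3"
  shows "rank_le_one X \<longleftrightarrow> (\<forall>Y. det (X + Y) - det (X - Y) = 2 * det Y)"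
proof
  assume X: "rank_le_one X"
  obtain u v where uv: "\<forall>i j. X $ i $ j = u i * v j"
    using X by (rule rank_le_oneE)
  show "\<forall>Y. det (X + Y) - det (X - Y) = 2 * det Y"
    by (simp add: det_3 uv algebra_simps)
next
  assume *: "\<forall>Y. det (X + Y) - det (X - Y) = 2 * det Y"
  \<comment> \<open>The difference cancels the even powers of \<open>t\<close> in
    \<open>det (X + t Y)\<close>. For a matrix unit \<open>Y\<close> the linear coefficient is a
    cofactor of \<open>X\<close>, so the nine choices give all 2 by 2 minors.\<close>
  have "det (X + munit i j) - det (X - munit i j) = 2 * det (munit i j)" for i j
    using * by blast
  from this[of 1 1] this[of 1 2] this[of 1 3] this[of 2 1] this[of 2 2] this[of 2 3]
    this[of 3 1] this[of 3 2] this[of 3 3]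
  show "rank_le_one X"
    unfolding rank_le_one_def forall_3 by (simp add: det_3 algebra_simps)
qed

text \<open>The criterion involves only determinants and sums, and by surjectivity its test matrices
  \<open>Y\<close> are all of the form \<open>L Z\<close>.\<close>

lemma rank_le_one_preserved:
  fixes L :: "real^3^3 \<Rightarrow> real^3^3"
  assumes L: "linear L" "surj L" "\<And>X. det (L X) = det X" and X: "rank_le_one X"
  shows "rank_le_one (L X)"
  unfolding rank_le_one_iff_det
proof
  fix Y
  obtain Z where Y: "Y = L Z" using L(2) by blast
  show "det (L X + Y) - det (L X - Y) = 2 * det Y"
    using X[unfolded rank_le_one_iff_det]
    by (simp add: Y L(3) flip: linear_add[OF L(1)] linear_diff[OF L(1)])
qed

lemma rank_le_one_munit: "rank_le_one (munit i j)"
  by (auto simp: rank_le_one_def)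

lemma rank_le_one_same_row: "rank_le_one (munit i j + munit i k)"
  by (auto simp: rank_le_one_def)

lemma rank_le_one_same_column: "rank_le_one (munit i j + munit k j)"
  by (auto simp: rank_le_one_def)

text \<open>Adding 1 to the entry \<open>(i, i)\<close> changes the minor on rows \<open>i\<close>,
  \<open>a\<close> and columns \<open>i\<close>, \<open>b\<close> by exactly
  \<open>M $ a $ b\<close>.\<close>

lemma rank_le_one_add_munit:
  assumes "rank_le_one M" "rank_le_one (M + munit i i)" "a \<noteq> i" "b \<noteq> i"
  shows "M $ a $ b = 0"
proof -
  have "(M $ i $ i + 1) * M $ a $ b = M $ i $ b * M $ a $ i"
    using assms(2)[unfolded rank_le_one_def, rule_format, of i i a b] assms(3,4) by simp
  moreover have "M $ i $ i * M $ a $ b = M $ i $ b * M $ a $ i"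
    using assms(1) unfolding rank_le_one_def by blast
  ultimately show ?thesis by (simp add: algebra_simps)
qed

section \<open>Determinant preservers that fix the diagonal matrix units\<close>

locale diagonal_fixing_det_preserver =
  fixes L :: "real^3^3 \<Rightarrow> real^3^3"
  assumes linear: "linear L" and surj: "surj L" and det: "\<And>X. det (L X) = det X"
    and diag: "\<And>i. L (munit i i) = munit i i"
begin

definition straight_coeff :: "3 \<Rightarrow> 3 \<Rightarrow> real"
  where "straight_coeff i j = L (munit i j) $ i $ j"

definition flipped_coeff :: "3 \<Rightarrow> 3 \<Rightarrow> real"
  where "flipped_coeff i j = L (munit i j) $ j $ i"

text \<open>\<open>munit i j\<close> shares a row with \<open>munit i i\<close> and a column with
  \<open>munit j j\<close>, so both sums keep rank one. This kills every entry outside row and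
  column \<open>i\<close>, and likewise for \<open>j\<close>; only two positions survive.\<close>

lemma munit_support:
  assumes ij: "i \<noteq> j" and ab: "(a, b) \<noteq> (i, j)" "(a, b) \<noteq> (j, i)"
  shows "L (munit i j) $ a $ b = 0"
proof -
  note pres = rank_le_one_preserved[OF linear surj det]
  have "rank_le_one (L (munit i j))"
    by (rule pres[OF rank_le_one_munit])
  moreover have "rank_le_one (L (munit i j) + munit i i)"
    using pres[OF rank_le_one_same_row[of i j i]] by (simp add: linear_add[OF linear] diag)
  moreover have "rank_le_one (L (munit i j) + munit j j)"
    using pres[OF rank_le_one_same_column[of i j j]] by (simp add: linear_add[OF linear] diag)
  ultimately have "a \<noteq> i \<Longrightarrow> b \<noteq> i \<Longrightarrow> ?thesis" "a \<noteq> j \<Longrightarrow> b \<noteq> j \<Longrightarrow> ?thesis"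
    by (blast intro: rank_le_one_add_munit)+
  with ij ab show ?thesis by auto
qed

text \<open>The minor on rows and columns \<open>i\<close>, \<open>j\<close> vanishes, and so do its
  diagonal entries. Hence each unit goes either straight or flipped, never to a mixture.\<close>

lemma coeff_cross:
  assumes "i \<noteq> j"
  shows "straight_coeff i j * flipped_coeff i j = 0"
proof -
  have "L (munit i j) $ i $ j * L (munit i j) $ j $ i
      = L (munit i j) $ i $ i * L (munit i j) $ j $ j"
    using rank_le_one_preserved[OF linear surj det rank_le_one_munit]
    unfolding rank_le_one_def by blast
  with assms show ?thesis by (simp add: munit_support straight_coeff_def flipped_coeff_def)
qed

lemma nth_diag: "L X $ i $ i = X $ i $ i"
  and nth_offdiag: "i \<noteq> j \<Longrightarrow>
    L X $ i $ j = X $ i $ j * straight_coeff i j + X $ j $ i * flipped_coeff j i"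
proof -
  have *: "L X $ a $ b = (\<Sum>i\<in>UNIV. \<Sum>j\<in>UNIV. X $ i $ j * L (munit i j) $ a $ b)" for a b
    by (subst matrix_eq_sum_munit[of X]) (simp add: linear_sum[OF linear] linear_scale[OF linear])
  show "L X $ i $ i = X $ i $ i"
    using exhaust_3[of i] unfolding * sum_3 by (auto simp: munit_support diag)
  show "L X $ i $ j = X $ i $ j * straight_coeff i j + X $ j $ i * flipped_coeff j i"
    if "i \<noteq> j"
    using exhaust_3[of i] exhaust_3[of j] that unfolding * sum_3
    by (auto simp: munit_support diag straight_coeff_def flipped_coeff_def)
qed

lemma transposition:
  assumes "i \<noteq> j"
  shows "straight_coeff i j * straight_coeff j i + flipped_coeff i j * flipped_coeff j i = 1"
proof -
  \<comment> \<open>The permutation matrix of a transposition; the bracket is the third diagonal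
    unit.\<close>
  let ?X = "munit i j + munit j i + (mat 1 - munit i i - munit j j)"
  have "det (L ?X) = det ?X"
    by (rule det)
  then have "(straight_coeff i j + flipped_coeff j i) * (straight_coeff j i + flipped_coeff i j) = 1"
    using exhaust_3[of i] exhaust_3[of j] assms
    by (elim disjE; simp add: det_3 nth_diag nth_offdiag mat_def mult.commute)
  then show ?thesis
    using coeff_cross[of i j] coeff_cross[of j i] assms
    by (auto simp: distrib_left distrib_right mult.commute)
qed

text \<open>Compares determinants at the permutation matrix of a 3-cycle. One of the two products
  must be nonzero, which decides between \<open>X\<close> and its transpose.\<close>

lemma three_cycle:
  "straight_coeff 1 2 * straight_coeff 2 3 * straight_coeff 3 1
    + flipped_coeff 1 2 * flipped_coeff 2 3 * flipped_coeff 3 1 = 1"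
  using det[of "munit 1 2 + munit 2 3 + munit 3 1"]
  by (simp add: det_3 nth_diag nth_offdiag mult_ac)

text \<open>The coefficients satisfy \<open>p i j = p i 1 * p 1 j\<close> off the diagonal, so
  \<open>L\<close> is conjugation by a diagonal matrix.\<close>

lemma straight:
  assumes "straight_coeff 1 2 * straight_coeff 2 3 * straight_coeff 3 1 \<noteq> 0"
  obtains D D' where "D ** D' = mat 1" "\<And>X. L X = D ** X ** D'"
proof -
  let ?p = straight_coeff and ?q = flipped_coeff
  \<comment> \<open>Nonzero straight coefficients along the cycle exclude the flipped ones there;
    \<open>transposition\<close> then makes the reversed straight coefficients nonzero too, which
    excludes the remaining flipped ones.\<close>
  have q0: "?q 1 2 = 0" "?q 2 3 = 0" "?q 3 1 = 0"
    using coeff_cross[of 1 2] coeff_cross[of 2 3] coeff_cross[of 3 1] assms by auto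
  have pp: "?p 1 2 * ?p 2 1 = 1" "?p 2 3 * ?p 3 2 = 1" "?p 3 1 * ?p 1 3 = 1"
    using transposition[of 1 2] transposition[of 2 3] transposition[of 3 1] q0 by auto
  then have q0': "?q 2 1 = 0" "?q 3 2 = 0" "?q 1 3 = 0"
    using coeff_cross[of 2 1] coeff_cross[of 3 2] coeff_cross[of 1 3] by auto
  have ppp: "?p 1 2 * ?p 2 3 * ?p 3 1 = 1"
    using three_cycle q0 by simp
  have p23: "?p 2 3 = ?p 2 1 * ?p 1 3"
  proof -
    have "?p 2 3 = (?p 1 2 * ?p 2 1) * (?p 3 1 * ?p 1 3) * ?p 2 3" by (simp add: pp)
    also have "\<dots> = (?p 1 2 * ?p 2 3 * ?p 3 1) * (?p 2 1 * ?p 1 3)" by (simp add: mult_ac)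
    finally show ?thesis by (simp add: ppp)
  qed
  have p32: "?p 3 2 = ?p 3 1 * ?p 1 2"
  proof -
    have "?p 3 2 = (?p 1 2 * ?p 2 3 * ?p 3 1) * ?p 3 2" by (simp add: ppp)
    also have "\<dots> = (?p 2 3 * ?p 3 2) * (?p 3 1 * ?p 1 2)" by (simp add: mult_ac)
    finally show ?thesis by (simp add: pp)
  qed
  have Lij: "L X $ 1 $ 2 = ?p 1 2 * X $ 1 $ 2" "L X $ 2 $ 1 = ?p 2 1 * X $ 2 $ 1"
    "L X $ 1 $ 3 = ?p 1 3 * X $ 1 $ 3" "L X $ 3 $ 1 = ?p 3 1 * X $ 3 $ 1"
    "L X $ 2 $ 3 = ?p 2 1 * ?p 1 3 * X $ 2 $ 3" "L X $ 3 $ 2 = ?p 3 1 * ?p 1 2 * X $ 3 $ 2" for X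
    by (simp_all add: nth_offdiag q0 q0' p23 p32)
  define D :: "real^3^3" where
    "D = (\<chi> i j. if i = j then (if i = 1 then 1 else ?p i 1) else 0)"
  define D' :: "real^3^3" where
    "D' = (\<chi> i j. if i = j then (if i = 1 then 1 else ?p 1 i) else 0)"
  have pp': "?p 2 1 * ?p 1 2 = 1" "?p 3 1 * ?p 1 3 = 1"
    using pp by (simp_all add: mult.commute)
  then have pp'': "?p 2 1 * (x * ?p 1 2) = x" "?p 3 1 * (x * ?p 1 3) = x" for x
    by (simp_all add: mult.left_commute)
  show ?thesis
  proof (rule that)
    show "D ** D' = mat 1"
      by (simp add: D_def D'_def matrix_matrix_mult_def mat_def vec_eq_iff forall_3 sum_3 pp')
    show "L X = D ** X ** D'" for X
      by (simp add: D_def D'_def matrix_matrix_mult_def vec_eq_iff forall_3 sum_3 nth_diag Lij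
          mult.assoc pp'')
  qed
qed

end

text \<open>Composing \<open>L\<close> with transposition exchanges straight and flipped
  coefficients, so by \<open>three_cycle\<close> the lemma \<open>straight\<close> applies to
  \<open>L\<close> or to the composite.\<close>

lemma det_preserver_fixing_diagonal:
  assumes "diagonal_fixing_det_preserver L"
  obtains D D' where "D ** D' = mat 1"
    "(\<forall>X. L X = D ** X ** D') \<or> (\<forall>X. L X = D ** transpose X ** D')"
proof -
  interpret diagonal_fixing_det_preserver L by fact
  define T where "T X = transpose (L X)" for X
  interpret T: diagonal_fixing_det_preserver T
  proof (rule diagonal_fixing_det_preserver.intro)
    show "linear T"
      by (rule linearI)
        (simp_all add: T_def linear_add[OF linear] linear_scale[OF linear] transpose_def vec_eq_iff)
    show "surj T"
      using surj by (metis T_def surj_def transpose_transpose)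
    show "det (T X) = det X" for X
      by (simp add: T_def det det_transpose)
    show "T (munit i i) = munit i i" for i
      by (auto simp: T_def diag transpose_def vec_eq_iff)
  qed
  have "T.straight_coeff i j = flipped_coeff i j" for i j
    by (simp add: T.straight_coeff_def flipped_coeff_def T_def transpose_def)
  then consider "straight_coeff 1 2 * straight_coeff 2 3 * straight_coeff 3 1 \<noteq> 0"
    | "T.straight_coeff 1 2 * T.straight_coeff 2 3 * T.straight_coeff 3 1 \<noteq> 0"
    using three_cycle by force
  then show ?thesis
  proof cases
    case 1
    then show ?thesis using straight that by metis
  next
    case 2
    then obtain D D' where D: "D ** D' = mat 1" "\<And>X. T X = D ** X ** D'"
      using T.straight by metis
    have "transpose D' ** transpose D = mat 1"
      by (metis D(1) matrix_transpose_mul transpose_mat)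
    moreover have "L X = transpose D' ** transpose X ** transpose D" for X
      by (metis D(2) T_def matrix_mul_assoc matrix_transpose_mul transpose_transpose)
    ultimately show ?thesis using that by blast
  qed
qed

text \<open>The images of the diagonal matrix units have rank one, and the factors of these images
  are the columns and rows of two matrices whose product is the image of the identity. Multiplying
  by their inverses on both sides reduces to the case of fixed diagonal matrix units.\<close>

proposition det_preserver_real_3:
  fixes L :: "real^3^3 \<Rightarrow> real^3^3"
  assumes L: "linear L" "surj L" "\<And>X. det (L X) = det X"
  obtains P Q where "det P = 1" "det Q = 1"
    "(\<forall>X. L X = P ** X ** Q) \<or> (\<forall>X. L X = P ** transpose X ** Q)"
proof -
  have "\<exists>u v. \<forall>a b. L (munit i i) $ a $ b = u a * v b" for i
    by (meson rank_le_oneE rank_le_one_preserved[OF L rank_le_one_munit])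
  then obtain u v where uv: "\<And>i a b. L (munit i i) $ a $ b = u i a * v i b" by metis
  define U :: "real^3^3" where "U = (\<chi> a i. u i a)"
  define W :: "real^3^3" where "W = (\<chi> i b. v i b)"
  have one: "munit 1 1 + munit 2 2 + munit 3 3 = (mat 1 :: real^3^3)"
    by (simp add: vec_eq_iff mat_def forall_3)
  have "U ** W = L (munit 1 1 + munit 2 2 + munit 3 3)"
    by (simp add: linear_add[OF L(1)] vec_eq_iff U_def W_def matrix_matrix_mult_def sum_3 uv)
  then have "det (U ** W) = 1" by (simp add: one L(3))
  then have dUW: "det U * det W = 1" by (simp add: det_mul)
  then have "invertible U" "invertible W" by (auto simp: invertible_det_nz)
  then obtain U' W' where U': "U ** U' = mat 1" "U' ** U = mat 1"
    and W': "W ** W' = mat 1" "W' ** W = mat 1"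
    unfolding invertible_def by blast
  let ?L = "\<lambda>X. U' ** L X ** W'"
  have L_eq: "U ** ?L X ** W = L X" for X
    by (metis U'(1) W'(2) matrix_mul_assoc matrix_mul_lid matrix_mul_rid)
  have "diagonal_fixing_det_preserver ?L"
  proof (rule diagonal_fixing_det_preserver.intro)
    show "linear ?L"
      using linear_compose[OF L(1) linear_matrix_mult_both] by (simp add: o_def)
    show "surj ?L"
    proof (rule surjI)
      show "?L (inv_into UNIV L (U ** Y ** W)) = Y" for Y
        by (metis L(2) U'(2) W'(1) matrix_mul_assoc matrix_mul_lid matrix_mul_rid surj_f_inv_f)
    qed
    have "det U' * det W' = (det U' * det W') * (det U * det W)" by (simp add: dUW)
    also have "\<dots> = det (U' ** U) * det (W' ** W)" by (simp add: det_mul)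
    finally have "det U' * det W' = 1" by (simp add: U' W')
    then show "det (?L X) = det X" for X
      by (simp add: det_mul L(3))
    show "?L (munit i i) = munit i i" for i
    proof -
      have "L (munit i i) = U ** munit i i ** W"
        using exhaust_3[of i]
        by (auto simp: vec_eq_iff uv U_def W_def matrix_matrix_mult_def sum_3)
      then show ?thesis
        by (metis U'(2) W'(1) matrix_mul_assoc matrix_mul_lid matrix_mul_rid)
    qed
  qed
  then obtain D D' where D: "D ** D' = mat 1"
    "(\<forall>X. ?L X = D ** X ** D') \<or> (\<forall>X. ?L X = D ** transpose X ** D')"
    by (rule det_preserver_fixing_diagonal)
  define P where "P = U ** D"
  define Q where "Q = D' ** W"
  have "L X = P ** Y ** Q" if "?L X = D ** Y ** D'" for X Y
    using L_eq[of X] unfolding that P_def Q_def by (simp add: matrix_mul_assoc)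
  with D(2) have PQ: "(\<forall>X. L X = P ** X ** Q) \<or> (\<forall>X. L X = P ** transpose X ** Q)"
    by metis
  have "det P * det Q = (det U * det W) * det (D ** D')"
    by (simp add: P_def Q_def det_mul)
  then have dPQ: "det P * det Q = 1" by (simp add: D dUW)
  \<comment> \<open>So far only the product of the two determinants is 1. Scaling by
    \<open>1 / c\<close> and \<open>c\<close> normalises both without changing the map.\<close>
  define c where "c = root 3 (det P)"
  have c3: "c ^ 3 = det P" by (simp add: c_def odd_real_root_pow)
  with dPQ have c0: "c \<noteq> 0" by auto
  have det_scale: "det (r *\<^sub>R M) = r ^ 3 * det M" for r and M :: "real^3^3"
    by (simp add: det_3 algebra_simps power3_eq_cube)
  show ?thesis
  proof (rule that)
    show "det ((1 / c) *\<^sub>R P) = 1"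
      using c0 by (simp add: det_scale power_divide flip: c3)
    show "det (c *\<^sub>R Q) = 1"
      using dPQ by (simp add: det_scale c3)
    have "(1 / c) *\<^sub>R P ** Y ** c *\<^sub>R Q = P ** Y ** Q" for Y
      using c0 by (simp add: matrix_scalar_ac flip: scalar_matrix_assoc)
    with PQ show "(\<forall>X. L X = (1 / c) *\<^sub>R P ** X ** c *\<^sub>R Q)
        \<or> (\<forall>X. L X = (1 / c) *\<^sub>R P ** transpose X ** c *\<^sub>R Q)"
      by simp
  qed
qed

section \<open>Splitting matrices over the split complex numbers\<close>

text \<open>The inverse of the entrywise isomorphism \<open>(mplus, mminus)\<close> onto pairs of
  real matrices.\<close>

definition split_mat :: "real^'n^'m \<Rightarrow> real^'n^'m \<Rightarrow> split_complex^'n^'m"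
  where "split_mat P Q = (\<chi> i j. SC ((P $ i $ j + Q $ i $ j) / 2) ((P $ i $ j - Q $ i $ j) / 2))"

lemma mplus_split_mat [simp]: "mplus (split_mat P Q) = P"
  and mminus_split_mat [simp]: "mminus (split_mat P Q) = Q"
  by (simp_all add: mplus_def mminus_def split_mat_def vec_eq_iff field_simps)

lemma mplus_mcnj [simp]: "mplus (mcnj A) = mminus A"
  and mminus_mcnj [simp]: "mminus (mcnj A) = mplus A"
  by (simp_all add: mplus_def mminus_def mcnj_def)

lemma mplus_adjoint: "mplus (adjoint_mat A) = transpose (mminus A)"
  and mminus_adjoint: "mminus (adjoint_mat A) = transpose (mplus A)"
  by (simp_all add: mplus_def mminus_def mcnj_def adjoint_mat_def transpose_def)

lemma det_mplus: "det (mplus A) = sRe (det A) + sIm (det A)"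
  and det_mminus: "det (mminus A) = sRe (det A) - sIm (det A)" for A :: "split_complex^3^3"
  by (simp_all add: mplus_def mminus_def det_3 algebra_simps)

text \<open>The \<open>mminus\<close> part of the unitarity equation is the transpose of its
  \<open>mplus\<close> part. So \<open>mminus A\<close> is the inverse transpose of
  \<open>mplus A\<close>, which may be any matrix of determinant 1.\<close>

lemma SU3_iff:
  "A \<in> carrier SU3 \<longleftrightarrow> mplus A ** transpose (mminus A) = mat 1 \<and> det (mplus A) = 1"
proof
  assume "A \<in> carrier SU3"
  then have "A ** adjoint_mat A = mat 1" "det A = 1" by (auto simp: SU3_def)
  then show "mplus A ** transpose (mminus A) = mat 1 \<and> det (mplus A) = 1"
    by (metis add_0_right det_mplus mplus_adjoint mplus_mult mplus_one split_complex_sel(3,4))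
next
  assume A: "mplus A ** transpose (mminus A) = mat 1 \<and> det (mplus A) = 1"
  then have "det (mplus A) * det (mminus A) = 1"
    by (metis det_I det_mul det_transpose)
  with A have "sRe (det A) + sIm (det A) = 1" "sRe (det A) - sIm (det A) = 1"
    by (simp_all flip: det_mplus det_mminus)
  then have "det A = 1"
    by (simp add: split_complex_eq_iff)
  moreover have "A ** adjoint_mat A = mat 1"
  proof (rule mplus_mminus_eqI)
    show "mplus (A ** adjoint_mat A) = mplus (mat 1)"
      using A by (simp add: mplus_mult mplus_adjoint mplus_one)
    have "transpose (mplus A ** transpose (mminus A)) = mat 1"
      using A by (simp add: transpose_mat)
    then show "mminus (A ** adjoint_mat A) = mminus (mat 1)"
      by (simp add: mminus_mult mminus_adjoint mminus_one matrix_transpose_mul)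
  qed
  ultimately show "A \<in> carrier SU3" by (simp add: SU3_def)
qed

text \<open>Conjugation exchanges \<open>mplus\<close> and \<open>mminus\<close>, so a hermitian
  matrix is determined by an arbitrary real matrix \<open>mplus X\<close>.\<close>

lemma J3_iff: "X \<in> J3 \<longleftrightarrow> mminus X = transpose (mplus X)"
proof
  show "mminus X = transpose (mplus X)" if "X \<in> J3"
    using that mminus_adjoint[of X] by (simp add: J3_def)
  show "X \<in> J3" if "mminus X = transpose (mplus X)"
    unfolding J3_def mem_Collect_eq
    by (rule mplus_mminus_eqI) (simp_all add: mplus_adjoint mminus_adjoint that transpose_transpose)
qed

text \<open>The inverse of \<open>mplus\<close> on \<open>J3\<close>.\<close>

definition herm :: "real^3^3 \<Rightarrow> split_complex^3^3"
  where "herm M = split_mat M (transpose M)"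

lemma mplus_herm [simp]: "mplus (herm M) = M"
  by (simp add: herm_def)

lemma herm_J3 [simp]: "herm M \<in> J3"
  by (simp add: J3_iff herm_def)

lemma herm_mplus: "X \<in> J3 \<Longrightarrow> herm (mplus X) = X"
  by (rule mplus_mminus_eqI) (simp_all add: herm_def J3_iff)

lemma jdet_eq_det_mplus: "X \<in> J3 \<Longrightarrow> jdet X = det (mplus X)"
  by (simp add: det_mplus flip: of_real_jdet)

lemma mplus_add: "mplus (X + Y) = mplus X + mplus Y"
  and mplus_scaleR: "mplus (r *\<^sub>R X) = r *\<^sub>R mplus X"
  by (simp_all add: mplus_def vec_eq_iff algebra_simps)

lemma herm_add: "herm (M + N) = herm M + herm N"
  and herm_scaleR: "herm (r *\<^sub>R M) = r *\<^sub>R herm M"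
  by (simp_all add: herm_def split_mat_def vec_eq_iff split_complex_eq_iff transpose_def field_simps)

lemma carrier_E6_6_C:
  "\<alpha> \<in> carrier E6_6_C \<longleftrightarrow>
    \<alpha> \<in> Bij J3 \<and> real_linear_on J3 \<alpha> \<and> (\<forall>X\<in>J3. jdet (\<alpha> X) = jdet X)"
  by (auto simp: E6_6_C_def IsoR_def)

lemma mult_E6_6_C:
  "\<alpha> \<in> carrier E6_6_C \<Longrightarrow> \<beta> \<in> carrier E6_6_C \<Longrightarrow> \<alpha> \<otimes>\<^bsub>E6_6_C\<^esub> \<beta> = compose J3 \<alpha> \<beta>"
  by (simp add: E6_6_C_def IsoR_def BijGroup_def)

section \<open>The action of the semi-direct product\<close>

type_synonym triple = "((split_complex^3^3) \<times> (split_complex^3^3)) \<times> int"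

abbreviation SU3_semidirect :: "triple monoid"
  where "SU3_semidirect \<equiv> semidirect_product (SU3 \<times>\<times> SU3) (integer_mod_group 2) eps_action"

text \<open>In the coordinates \<open>mplus\<close>, \<open>(A, B)\<close> acts by \<open>M \<mapsto> A M B\<inverse>\<close> and \<open>\<epsilon>\<close> by transposition, because
  \<open>transpose (mminus B)\<close> is the inverse of \<open>mplus B\<close> for \<open>B\<close> in \<open>SU3\<close>.\<close>

fun real_action :: "triple \<Rightarrow> real^3^3 \<Rightarrow> real^3^3"
  where "real_action ((A, B), k) M =
    mplus A ** (if k = 0 then M else transpose M) ** transpose (mminus B)"

definition J3_action :: "triple \<Rightarrow> split_complex^3^3 \<Rightarrow> split_complex^3^3"
  where "J3_action g = (\<lambda>X\<in>J3. herm (real_action g (mplus X)))"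

lemma carrier_semidirect:
  "((A, B), k) \<in> carrier SU3_semidirect \<longleftrightarrow>
    A \<in> carrier SU3 \<and> B \<in> carrier SU3 \<and> (k = 0 \<or> k = 1)"
  by (auto simp: semidirect_product_def carrier_integer_mod_group)

text \<open>Transposing \<open>A M B^-1\<close> swaps the factors and turns them into inverse
  transposes of \<open>B\<close> and \<open>A\<close>, which are the \<open>mplus\<close> parts of
  \<open>mcnj B\<close> and \<open>mcnj A\<close> up to the inversion in the second slot. This is
  \<open>eps_map\<close>.\<close>

lemma real_action_mult:
  assumes "g \<in> carrier SU3_semidirect" "h \<in> carrier SU3_semidirect"
  shows "real_action (g \<otimes>\<^bsub>SU3_semidirect\<^esub> h) M = real_action g (real_action h M)"
proof -
  obtain A B k where g: "g = ((A, B), k)" by (metis surj_pair)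
  obtain A' B' k' where h: "h = ((A', B'), k')" by (metis surj_pair)
  have "k = 0 \<or> k = 1" "k' = 0 \<or> k' = 1"
    using assms by (simp_all add: g h carrier_semidirect)
  then show ?thesis
    by (auto simp: g h semidirect_product_def eps_action_def eps_map_def SU3_def mplus_mult
        mminus_mult matrix_transpose_mul matrix_mul_assoc transpose_transpose)
qed

lemma det_real_action:
  assumes "g \<in> carrier SU3_semidirect"
  shows "det (real_action g M) = det M"
proof -
  obtain A B k where g: "g = ((A, B), k)" by (metis surj_pair)
  then have A: "det (mplus A) = 1" and B: "B \<in> carrier SU3"
    using assms by (auto simp: carrier_semidirect SU3_iff)
  \<comment> \<open>\<open>SU3_iff\<close> is applied to \<open>mcnj B\<close>, whose
    \<open>mplus\<close> part is \<open>mminus B\<close>.\<close>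
  have "det (mminus B) = 1"
    using mcnj_SU3[OF B] by (simp add: SU3_iff)
  with A show ?thesis by (simp add: g det_mul det_transpose)
qed

lemma linear_real_action:
  "real_action g (M + N) = real_action g M + real_action g N"
  "real_action g (r *\<^sub>R M) = r *\<^sub>R real_action g M"
proof -
  obtain A B k where g: "g = ((A, B), k)" by (metis surj_pair)
  have "transpose (M + N) = transpose M + transpose N" "transpose (r *\<^sub>R M) = r *\<^sub>R transpose M"
    by (simp_all add: transpose_def vec_eq_iff)
  then show "real_action g (M + N) = real_action g M + real_action g N"
    "real_action g (r *\<^sub>R M) = r *\<^sub>R real_action g M"
    by (simp_all add: g linear_add[OF linear_matrix_mult_both]
        linear_scale[OF linear_matrix_mult_both])
qed

lemma real_action_one: "real_action \<one>\<^bsub>SU3_semidirect\<^esub> M = M"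
  by (simp add: semidirect_product_def SU3_def mplus_one mminus_one transpose_mat)

lemma J3_action_J3 [simp]: "X \<in> J3 \<Longrightarrow> J3_action g X \<in> J3"
  by (simp add: J3_action_def)

lemma J3_action_mult:
  assumes "g \<in> carrier SU3_semidirect" "h \<in> carrier SU3_semidirect" "X \<in> J3"
  shows "J3_action (g \<otimes>\<^bsub>SU3_semidirect\<^esub> h) X = J3_action g (J3_action h X)"
  using assms by (simp add: J3_action_def real_action_mult)

lemma J3_action_closed:
  assumes g: "g \<in> carrier SU3_semidirect"
  shows "J3_action g \<in> carrier E6_6_C"
  unfolding carrier_E6_6_C
proof (intro conjI ballI)
  interpret group SU3_semidirect by (rule group_SU3_semidirect)
  let ?h = "inv\<^bsub>SU3_semidirect\<^esub> g"
  have one: "J3_action \<one>\<^bsub>SU3_semidirect\<^esub> X = X" if "X \<in> J3" for X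
    using that by (simp add: J3_action_def real_action_one herm_mplus)
  have "bij_betw (J3_action g) J3 J3"
  proof (rule bij_betw_byWitness[where f' = "J3_action ?h"])
    show "\<forall>X\<in>J3. J3_action ?h (J3_action g X) = X" "\<forall>X\<in>J3. J3_action g (J3_action ?h X) = X"
      using g by (simp_all add: one flip: J3_action_mult)
  qed auto
  then show "J3_action g \<in> Bij J3"
    by (simp add: Bij_def J3_action_def)
  show "real_linear_on J3 (J3_action g)"
    by (simp add: real_linear_on_def J3_action_def J3_add J3_scaleR mplus_add mplus_scaleR
        linear_real_action herm_add herm_scaleR)
  show "jdet (J3_action g X) = jdet X" if "X \<in> J3" for X
    using that g by (simp add: J3_action_def jdet_eq_det_mplus det_real_action)
qed

lemma J3_action_hom: "J3_action \<in> hom SU3_semidirect E6_6_C"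
proof (rule homI)
  fix g h assume gh: "g \<in> carrier SU3_semidirect" "h \<in> carrier SU3_semidirect"
  then show "J3_action (g \<otimes>\<^bsub>SU3_semidirect\<^esub> h) = J3_action g \<otimes>\<^bsub>E6_6_C\<^esub> J3_action h"
    by (auto simp: mult_E6_6_C J3_action_closed compose_def J3_action_mult fun_eq_iff)
      \<comment> \<open>Outside \<open>J3\<close> both sides are \<open>undefined\<close>.\<close>
      (simp add: J3_action_def)
qed (rule J3_action_closed)

section \<open>Injectivity of the action\<close>

text \<open>Evaluation at the identity matrix makes the two factors mutually inverse. Then
  \<open>?P\<close> commutes with every matrix, hence is scalar, and its determinant forces the
  scalar to be 1.\<close>

lemma real_action_faithful:
  assumes g: "g \<in> carrier SU3_semidirect" and id: "\<And>M. real_action g M = M"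
  shows "g = \<one>\<^bsub>SU3_semidirect\<^esub>"
proof -
  obtain A B k where g_eq: "g = ((A, B), k)" by (metis surj_pair)
  then have A: "A \<in> carrier SU3" and B: "B \<in> carrier SU3" and k: "k = 0 \<or> k = 1"
    using g by (simp_all add: carrier_semidirect)
  let ?P = "mplus A" and ?Q = "transpose (mminus B)"
  have detP: "det ?P = 1" using A by (simp add: SU3_iff)
  have "?P ** ?Q = mat 1"
    using id[of "mat 1"] by (simp add: g_eq transpose_mat split: if_splits)
  then have QP: "?Q ** ?P = mat 1" by (simp add: matrix_left_right_inverse)
  have comm: "?P ** (if k = 0 then M else transpose M) = M ** ?P" for M
  proof -
    have "M ** ?P = ?P ** (if k = 0 then M else transpose M) ** ?Q ** ?P"
      using id[of M] by (simp add: g_eq)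
    also have "\<dots> = ?P ** (if k = 0 then M else transpose M)"
      by (simp add: QP flip: matrix_mul_assoc)
    finally show ?thesis by simp
  qed
  have nth: "(?P ** (if k = 0 then munit i j else transpose (munit i j))) $ a $ b
    = (munit i j ** ?P) $ a $ b" for i j a b
    by (simp only: comm)
  have k0: "k = 0"
  proof (rule ccontr)
    assume "k \<noteq> 0"
    \<comment> \<open>With a transposition present, the units \<open>munit 2 2\<close> and
      \<open>munit 1 2\<close> make the second column of \<open>?P\<close> vanish.\<close>
    then have "?P $ 1 $ 2 = 0" "?P $ 2 $ 2 = 0" "?P $ 3 $ 2 = 0"
      using nth[of 2 2 1 2] nth[of 1 2 2 1] nth[of 2 2 3 2]
      by (simp_all add: transpose_munit matrix_mult_munit_nth munit_mult_matrix_nth)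
    with detP show False by (simp add: det_3)
  qed
  have off: "?P $ i $ j = 0" if "i \<noteq> j" for i j
    using nth[of j j i j] that by (simp add: k0 matrix_mult_munit_nth munit_mult_matrix_nth)
  have dia: "?P $ i $ i = ?P $ j $ j" for i j
    using nth[of i j i j] by (simp add: k0 matrix_mult_munit_nth munit_mult_matrix_nth)
  have "?P $ 1 $ 1 ^ 3 = 1"
    using detP by (simp add: det_3 off dia[of 2 1] dia[of 3 1] power3_eq_cube)
  \<comment> \<open>The only real cube root of 1 is 1.\<close>
  then have "?P $ 1 $ 1 = 1"
    using odd_real_root_power_cancel[of 3 "?P $ 1 $ 1"] by simp
  then have "?P $ i $ i = 1" for i
    using dia[of i 1] by simp
  then have P1: "?P = mat 1"
    by (simp add: vec_eq_iff mat_def off)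
  with QP have Q1: "?Q = mat 1" by simp
  have "A = mat 1"
  proof (rule mplus_mminus_eqI)
    show "mminus A = mminus (mat 1)"
      using A by (simp add: SU3_iff P1 mminus_one) (metis transpose_mat transpose_transpose)
  qed (simp add: P1 mplus_one)
  moreover have "B = mat 1"
  proof (rule mplus_mminus_eqI)
    show "mminus B = mminus (mat 1)"
      using Q1 by (metis mminus_one transpose_mat transpose_transpose)
    show "mplus B = mplus (mat 1)"
      using B Q1 by (simp add: SU3_iff mplus_one)
  qed
  ultimately show ?thesis
    by (simp add: g_eq k0 semidirect_product_def SU3_def)
qed

section \<open>Surjectivity of the action\<close>

lemma J3_action_surj:
  assumes "\<alpha> \<in> carrier E6_6_C"
  shows "\<exists>g\<in>carrier SU3_semidirect. J3_action g = \<alpha>"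
proof -
  have bij: "bij_betw \<alpha> J3 J3" and ext: "\<alpha> \<in> extensional J3" and lin: "real_linear_on J3 \<alpha>"
    and jd: "\<And>X. X \<in> J3 \<Longrightarrow> jdet (\<alpha> X) = jdet X"
    using assms by (auto simp: carrier_E6_6_C Bij_def)
  have mem: "\<alpha> X \<in> J3" if "X \<in> J3" for X using bij that by (rule bij_betwE[rule_format])
  let ?L = "\<lambda>M. mplus (\<alpha> (herm M))"
  have "linear ?L"
    using lin by (intro linearI)
      (simp_all add: real_linear_on_def herm_add herm_scaleR mplus_add mplus_scaleR)
  moreover have "surj ?L"
  proof (rule surjI)
    fix M
    have "inv_into J3 \<alpha> (herm M) \<in> J3" "\<alpha> (inv_into J3 \<alpha> (herm M)) = herm M"
      using bij by (auto simp: bij_betw_def inv_into_into f_inv_into_f)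
    then show "?L (mplus (inv_into J3 \<alpha> (herm M))) = M"
      by (simp add: herm_mplus)
  qed
  moreover have "det (?L M) = det M" for M
    using jd[of "herm M"] by (simp add: jdet_eq_det_mplus mem)
  ultimately obtain P Q where P: "det P = 1" and Q: "det Q = 1"
    and PQ: "(\<forall>M. ?L M = P ** M ** Q) \<or> (\<forall>M. ?L M = P ** transpose M ** Q)"
    using det_preserver_real_3 by metis
  obtain P' where P': "P ** P' = mat 1"
    using P by (metis invertible_def invertible_det_nz zero_neq_one)
  obtain Q' where Q': "Q' ** Q = mat 1"
    using Q by (metis invertible_def invertible_det_nz zero_neq_one)
  then have "det (Q' ** Q) = 1" by simp
  then have detQ': "det Q' = 1" using Q by (simp add: det_mul)
  \<comment> \<open>The \<open>mplus\<close> part of \<open>A\<close> is \<open>P\<close>, and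
    \<open>SU3_iff\<close> dictates its \<open>mminus\<close> part. The action uses
    \<open>transpose (mminus B)\<close>, which has to be \<open>Q\<close>, so the
    \<open>mplus\<close> part of \<open>B\<close> is the inverse of \<open>Q\<close>.\<close>
  define A where "A = split_mat P (transpose P')"
  define B where "B = split_mat Q' (transpose Q)"
  have AB: "A \<in> carrier SU3" "B \<in> carrier SU3"
    by (simp_all add: SU3_iff A_def B_def transpose_transpose P P' Q' detQ')
  obtain k :: int where k: "k = 0 \<or> k = 1"
    and Lk: "\<And>M. ?L M = P ** (if k = 0 then M else transpose M) ** Q"
    using PQ
  proof
    assume "\<forall>M. ?L M = P ** M ** Q" then show ?thesis using that[of 0] by simp
  next
    assume "\<forall>M. ?L M = P ** transpose M ** Q" then show ?thesis using that[of 1] by simp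
  qed
  show ?thesis
  proof (rule bexI)
    show "((A, B), k) \<in> carrier SU3_semidirect"
      using AB k by (simp add: carrier_semidirect)
    show "J3_action ((A, B), k) = \<alpha>"
    proof (rule extensionalityI[OF _ ext])
      show "J3_action ((A, B), k) \<in> extensional J3" by (simp add: J3_action_def)
      fix X assume X: "X \<in> J3"
      have "real_action ((A, B), k) (mplus X) = ?L (mplus X)"
        by (simp add: Lk A_def B_def transpose_transpose)
      then show "J3_action ((A, B), k) X = \<alpha> X"
        using X by (simp add: J3_action_def herm_mplus mem)
    qed
  qed
qed

theorem theorem4p3p4:
  shows "E6_6_C \<cong> semidirect_product (SU3 \<times>\<times> SU3) (integer_mod_group 2) eps_action"
proof -
  interpret group_hom SU3_semidirect E6_6_C J3_action
    by (simp add: group_hom_def group_hom_axioms_def group_SU3_semidirect group_E6_6_C J3_action_hom)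
  have "inj_on J3_action (carrier SU3_semidirect)"
    unfolding inj_on_one_iff
  proof (intro allI impI)
    fix g assume g: "g \<in> carrier SU3_semidirect" and *: "J3_action g = \<one>\<^bsub>E6_6_C\<^esub>"
    have "real_action g M = M" for M
    proof -
      have "herm (real_action g M) = herm M"
        using fun_cong[OF *, of "herm M"]
        by (simp add: J3_action_def E6_6_C_def IsoR_def BijGroup_def)
      then show ?thesis by (metis mplus_herm)
    qed
    with g show "g = \<one>\<^bsub>SU3_semidirect\<^esub>" by (rule real_action_faithful)
  qed
  moreover have "J3_action ` carrier SU3_semidirect = carrier E6_6_C"
    using J3_action_closed J3_action_surj by blast
  ultimately have "J3_action \<in> iso SU3_semidirect E6_6_C"
    using J3_action_hom by (simp add: iso_def bij_betw_def)
  then have "SU3_semidirect \<cong> E6_6_C" by (rule is_isoI)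
  then show ?thesis by (rule G.iso_sym)
qed

end
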